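(* Let $m\ge 1$ and $k\ge 2$ be integers. The topological entropy of the shift space $T_{m,k}$ is $$h_{T_{m,k}}=\log(\lambda_0),$$ where $\lambda_0$ is the largest real root of the equation $\lambda^{m+1}=\lambda^{m}+(k-1)$. In particular, for $m=1$, $$h_{T_{1,k}}=\log\left(\frac{1+\sqrt{4k-3}}{2}\right).$$
   Context: For integers $m\ge 1$, $k\ge 2$, the shift space $T_{m,k}$ is the set of all bi-infinite sequences $(x_i)_{i\in\mathbb{Z}}$ over the alphabet $\{0,1,\dots,k-1\}$ in which each symbol other than $0$ appears isolated and is separated by at least $m$ $0$'s from any other occurrence of a nonzero symbol (i.e. any two nonzero entries are separated by at least $m$ zeros). A block of length $n$ is a finite sequence of $n$ consecutive symbols; it is allowed in a shift space $X$ if it occurs in some sequence of $X$. The topological entropy of a shift space $X$ is $h=\lim_{n\to\infty}\frac{\log \#(n)}{n}$, where $\#(n)$ is the number of different allowed blocks of length $n$ in $X$. *)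

theory Defs
  imports "HOL-Analysis.Analysis"
begin

text \<open>For \<open>m \<ge> 1\<close> the separation condition subsumes that nonzero symbols are isolated.\<close>

definition T_shift :: "nat \<Rightarrow> nat \<Rightarrow> (int \<Rightarrow> nat) set" where
  "T_shift m k = {x. (\<forall>i. x i \<in> {0..<k}) \<and>
     (\<forall>i j. i < j \<and> x i \<noteq> 0 \<and> x j \<noteq> 0 \<longrightarrow> m \<le> card {l \<in> {i<..<j}. x l = 0})}"

definition allowed_blocks :: "(int \<Rightarrow> 'a) set \<Rightarrow> nat \<Rightarrow> 'a list set" where
  "allowed_blocks X n = {map (\<lambda>l. x (i + int l)) [0..<n] | x i. x \<in> X}"

definition entropy_seq :: "(int \<Rightarrow> 'a) set \<Rightarrow> nat \<Rightarrow> real" where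
  "entropy_seq X n = ln (real (card (allowed_blocks X n))) / real n"

text \<open>Only meaningful when \<^term>\<open>convergent (entropy_seq X)\<close> holds.\<close>

definition topological_entropy :: "(int \<Rightarrow> 'a) set \<Rightarrow> real" where
  "topological_entropy X = lim (entropy_seq X)"

definition is_largest_root :: "nat \<Rightarrow> nat \<Rightarrow> real \<Rightarrow> bool" where
  "is_largest_root m k r \<longleftrightarrow>
     r ^ (m + 1) = r ^ m + (real k - 1) \<and>
     (\<forall>s::real. s ^ (m + 1) = s ^ m + (real k - 1) \<longrightarrow> s \<le> r)"

end

(* Deleting a leading 0, or a leading nonzero symbol together with the m zeros it forces, gives the
   recursion a(n+1) = a(n) + (k-1) a(n-m) for the number a(n) of allowed blocks, where a(j) = 1 for
   negative j.  If r > 1 solves r^(m+1) = r^m + (k-1), induction gives r^n <= a(n) <= r^(n+m), hence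
   log a(n) / n tends to log r. *)

theory Submission
  imports Defs
begin

section \<open>Allowed blocks\<close>

text \<open>The separation condition as a distance: m zeros strictly between two nonzero entries
  require an index gap above m.\<close>

definition separated :: "nat \<Rightarrow> nat list \<Rightarrow> bool" where
  "separated m w \<longleftrightarrow> (\<forall>i j. i < j \<longrightarrow> j < length w \<longrightarrow> w ! i \<noteq> 0 \<longrightarrow> w ! j \<noteq> 0 \<longrightarrow> i + m < j)"

definition separated_words :: "nat \<Rightarrow> nat \<Rightarrow> nat \<Rightarrow> nat list set" where
  "separated_words m k n = {w. length w = n \<and> set w \<subseteq> {..<k} \<and> separated m w}"

text \<open>The zeros counted lie among the j - i - 1 positions between i and j, which gives one
  direction. Conversely, the distance condition, applied to i and each of the m positions after it,
  makes all of these zero, and they lie before j.\<close>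

lemma T_shift_iff_distance:
  "x \<in> T_shift m k \<longleftrightarrow>
     (\<forall>i. x i < k) \<and> (\<forall>i j. i < j \<longrightarrow> x i \<noteq> 0 \<longrightarrow> x j \<noteq> 0 \<longrightarrow> i + int m < j)"
proof -
  have "i + int m < j"
    if "i < j" "m \<le> card {l \<in> {i<..<j}. x l = 0}" for i j :: int
  proof -
    have "card {l \<in> {i<..<j}. x l = 0} \<le> card {i<..<j}"
      by (rule card_mono) auto
    then show ?thesis using that by simp
  qed
  moreover have "m \<le> card {l \<in> {i<..<j}. x l = 0}"
    if sep: "\<forall>i j. i < j \<longrightarrow> x i \<noteq> 0 \<longrightarrow> x j \<noteq> 0 \<longrightarrow> i + int m < j"
      and "i < j" "x i \<noteq> 0" "x j \<noteq> 0" for i j :: int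
  proof -
    have "i + int m < j" using that by blast
    moreover have "x l = 0" if "l \<in> {i<..i + int m}" for l
      using sep \<open>x i \<noteq> 0\<close> that by force
    ultimately have "{i<..i + int m} \<subseteq> {l \<in> {i<..<j}. x l = 0}"
      by auto
    then have "card {i<..i + int m} \<le> card {l \<in> {i<..<j}. x l = 0}"
      by (intro card_mono finite_subset[OF _ finite_greaterThanLessThan_int[of i j]]) auto
    then show ?thesis by simp
  qed
  ultimately show ?thesis
    unfolding T_shift_def by (auto; meson)
qed

text \<open>Separation passes to windows. Conversely, padding a separated word with zeros on both
  sides creates no new nonzero pair, and 0 < k makes 0 a legal symbol.\<close>

lemma allowed_blocks_T_shift:
  assumes "0 < k"
  shows "allowed_blocks (T_shift m k) n = separated_words m k n"
proof (intro subset_antisym subsetI)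
  fix w assume "w \<in> allowed_blocks (T_shift m k) n"
  then obtain x i where w: "w = map (\<lambda>l. x (i + int l)) [0..<n]" and x: "x \<in> T_shift m k"
    unfolding allowed_blocks_def by blast
  have lt: "x l < k" for l
    using x by (simp add: T_shift_iff_distance)
  have "p + m < q" if "p < q" "x (i + int p) \<noteq> 0" "x (i + int q) \<noteq> 0" for p q
  proof -
    have "i + int p < i + int q" using that by simp
    then have "i + int p + int m < i + int q"
      using x that unfolding T_shift_iff_distance by blast
    then show ?thesis by linarith
  qed
  then show "w \<in> separated_words m k n"
    using lt by (auto simp: w separated_words_def separated_def)
next
  fix w assume w: "w \<in> separated_words m k n"
  define x where "x = (\<lambda>i::int. if 0 \<le> i \<and> i < int n then w ! nat i else 0)"
  have "x i < k" for i
    using w assms by (auto simp: x_def separated_words_def subset_iff)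
  moreover have "i + int m < j" if ij: "i < j" "x i \<noteq> 0" "x j \<noteq> 0" for i j
  proof -
    have r: "0 \<le> i" "j < int n" "w ! nat i \<noteq> 0" "w ! nat j \<noteq> 0"
      using ij by (auto simp: x_def split: if_splits)
    then have "nat i < nat j" "nat j < length w"
      using ij w by (auto simp: separated_words_def)
    then have "nat i + m < nat j"
      using w r unfolding separated_words_def separated_def by blast
    then show ?thesis using r by linarith
  qed
  ultimately have "x \<in> T_shift m k"
    by (auto simp: T_shift_iff_distance)
  moreover have "w = map (\<lambda>l. x (0 + int l)) [0..<n]"
    using w by (intro nth_equalityI) (auto simp: x_def separated_words_def)
  ultimately show "w \<in> allowed_blocks (T_shift m k) n"
    unfolding allowed_blocks_def by blast
qed

section \<open>Decomposition by the first symbol\<close>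

lemma separated_Cons:
  "separated m (c # w) \<longleftrightarrow>
     separated m w \<and> (c \<noteq> 0 \<longrightarrow> (\<forall>j < min m (length w). w ! j = 0))"
  (is "?L \<longleftrightarrow> ?R")
proof
  assume L: ?L
  have "i + m < j" if "i < j" "j < length w" "w ! i \<noteq> 0" "w ! j \<noteq> 0" for i j
    using L[unfolded separated_def, rule_format, of "Suc i" "Suc j"] that by simp
  moreover have "w ! j = 0" if "c \<noteq> 0" "j < m" "j < length w" for j
    using L[unfolded separated_def, rule_format, of 0 "Suc j"] that by force
  ultimately show ?R unfolding separated_def by auto
next
  assume R: ?R
  show ?L unfolding separated_def
  proof (intro allI impI)
    fix i j assume ij: "i < j" "j < length (c # w)" "(c # w) ! i \<noteq> 0" "(c # w) ! j \<noteq> 0"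
    then obtain j' where j': "j = Suc j'" by (cases j) auto
    show "i + m < j"
    proof (cases i)
      case 0
      \<comment> \<open>For j' < m the entry at j would be zero by \<open>?R\<close>; otherwise m
        \<le> j' already gives m < Suc j'.\<close>
      then show ?thesis using R ij j' by (cases "j' < m") auto
    next
      case (Suc i')
      then show ?thesis using R ij j' unfolding separated_def by force
    qed
  qed
qed

lemma separated_replicate_append: "separated m (replicate p 0 @ w) \<longleftrightarrow> separated m w"
  by (induction p) (simp_all add: separated_Cons)

lemma finite_separated_words: "finite (separated_words m k n)"
  by (rule finite_subset[OF _ finite_lists_length_eq[of "{..<k}" n]])
    (auto simp: separated_words_def)

lemma separated_words_0: "separated_words m k 0 = {[]}"
  by (auto simp: separated_words_def separated_def)

text \<open>A leading 0 leaves the rest free; a nonzero symbol forces m zeros, after which the rest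
  is free again. If n < m, the zeros fill the whole remainder: \<open>min m n\<close> cuts them off
  and the truncated \<open>n - m\<close> leaves the empty tail.\<close>

lemma separated_words_Suc:
  assumes "0 < k"
  shows "separated_words m k (Suc n) =
    (#) 0 ` separated_words m k n \<union>
    (\<lambda>(c, w). c # replicate (min m n) 0 @ w) ` ({1..<k} \<times> separated_words m k (n - m))"
    (is "?L = ?A \<union> ?B")
proof (intro subset_antisym subsetI)
  fix v assume v: "v \<in> ?L"
  then obtain c u where cu: "v = c # u" by (cases v) (auto simp: separated_words_def)
  have u: "length u = n" "set u \<subseteq> {..<k}" "separated m u" "c < k"
    and z: "c \<noteq> 0 \<Longrightarrow> \<forall>j < min m n. u ! j = 0"
    using v by (auto simp: cu separated_words_def separated_Cons)
  show "v \<in> ?A \<union> ?B"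
  proof (cases "c = 0")
    case True
    then show ?thesis using u by (auto simp: cu separated_words_def)
  next
    case False
    have "take m u = replicate (min m n) 0"
      using z[OF False] u by (intro nth_equalityI) auto
    then have u': "u = replicate (min m n) 0 @ drop m u"
      by (metis append_take_drop_id)
    then have "separated m (drop m u)"
      using u separated_replicate_append by metis
    then have "drop m u \<in> separated_words m k (n - m)"
      using u set_drop_subset[of m u] by (auto simp: separated_words_def)
    moreover have "v = (\<lambda>(c, w). c # replicate (min m n) 0 @ w) (c, drop m u)"
      using u' cu by simp
    ultimately have "v \<in> ?B"
      using False u(4) by (intro image_eqI[where x = "(c, drop m u)"]) auto
    then show ?thesis by simp
  qed
next
  fix v assume "v \<in> ?A \<union> ?B"
  then show "v \<in> ?L"
    using assms
    by (auto simp: separated_words_def separated_Cons separated_replicate_append nth_append)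
qed

text \<open>The first symbol separates the two images, and each map is injective because its
  inserted prefix has fixed length. For n < m the last factor counts only the empty word, realizing
  the value 1 at negative indices.\<close>

lemma card_separated_words_Suc:
  assumes "0 < k"
  shows "card (separated_words m k (Suc n)) =
    card (separated_words m k n) + (k - 1) * card (separated_words m k (n - m))"
proof -
  have "inj_on (\<lambda>(c, w). c # replicate (min m n) 0 @ w)
          ({1..<k} \<times> separated_words m k (n - m))"
    by (auto simp: inj_on_def)
  moreover have "(#) 0 ` separated_words m k n \<inter>
      (\<lambda>(c, w). c # replicate (min m n) 0 @ w) ` ({1..<k} \<times> separated_words m k (n - m)) = {}"
    by auto
  ultimately show ?thesis
    unfolding separated_words_Suc[OF assms]
    by (subst card_Un_disjoint)
      (auto simp: finite_separated_words card_image card_cartesian_product inj_on_def)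
qed

section \<open>Growth rate\<close>

lemma card_separated_words_bounds:
  fixes r :: real
  assumes "1 < r" and root: "r ^ (m + 1) = r ^ m + (real k - 1)"
  shows "r ^ n \<le> card (separated_words m k n) \<and> card (separated_words m k n) \<le> r ^ (n + m)"
proof -
  define a where "a n = real (card (separated_words m k n))" for n
  \<comment> \<open>With r > 1 the root equation makes k - 1 positive, so natural and real
    subtraction agree and multiplying by k - 1 preserves inequalities.\<close>
  have "r ^ m < r ^ (m + 1)" using assms(1) by simp
  then have k: "0 < k" "0 < real k - 1" using root by linarith+
  have a0: "a 0 = 1" by (simp add: a_def separated_words_0)
  have aSuc: "a (Suc n) = a n + (real k - 1) * a (n - m)" for n
    using k by (simp add: a_def card_separated_words_Suc of_nat_diff)
  \<comment> \<open>The root equation times r^l: powers of r solve the recursion. It is used at l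
    for the upper bound and at l - m for the lower one.\<close>
  have shift: "r ^ (l + m) + (real k - 1) * r ^ l = r ^ Suc (l + m)" for l
  proof -
    have "r ^ (l + m) + (real k - 1) * r ^ l = r ^ l * (r ^ m + (real k - 1))"
      by (simp add: power_add algebra_simps)
    also have "\<dots> = r ^ Suc (l + m)" unfolding root[symmetric] by (simp add: power_add)
    finally show ?thesis .
  qed
  have "r ^ n \<le> a n \<and> a n \<le> r ^ (n + m)"
  proof (induction n rule: less_induct)
    case (less n)
    show ?case
    proof (cases n)
      case 0
      then show ?thesis using assms(1) a0 by (simp add: one_le_power)
    next
      case (Suc l)
      then have IH: "r ^ l \<le> a l" "a l \<le> r ^ (l + m)"
          "r ^ (l - m) \<le> a (l - m)" "a (l - m) \<le> r ^ (l - m + m)"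
        using less.IH[of l] less.IH[of "l - m"] by simp_all
      \<comment> \<open>If l < m, then r^(l - m) is 1 and the claim becomes r^l (r - 1) \<le> k - 1
        = r^m (r - 1).\<close>
      have lower: "r ^ Suc l \<le> r ^ l + (real k - 1) * r ^ (l - m)"
      proof (cases "m \<le> l")
        case True
        then show ?thesis using shift[of "l - m"] by simp
      next
        case False
        then have "r ^ l * (r - 1) \<le> r ^ m * (r - 1)"
          using assms(1) by (intro mult_right_mono power_increasing) auto
        also have "\<dots> = real k - 1" using root by (simp add: algebra_simps)
        finally show ?thesis using False by (simp add: algebra_simps)
      qed
      \<comment> \<open>If l < m, the left side is a 0 = 1; the extra m in the exponent of the upper
        bound absorbs these initial values.\<close>
      have upper: "a (l - m) \<le> r ^ l"
        using IH(4) a0 assms(1) by (cases "m \<le> l") (auto simp: one_le_power)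
      have "(real k - 1) * r ^ (l - m) \<le> (real k - 1) * a (l - m)"
           "(real k - 1) * a (l - m) \<le> (real k - 1) * r ^ l"
        using IH upper k by (auto intro: mult_left_mono)
      then show ?thesis
        using IH lower shift[of l] unfolding Suc aSuc by simp
    qed
  qed
  then show ?thesis by (simp add: a_def)
qed

lemma entropy_seq_T_shift_tendsto:
  fixes r :: real
  assumes "1 < r" and "r ^ (m + 1) = r ^ m + (real k - 1)"
  shows "entropy_seq (T_shift m k) \<longlonglongrightarrow> ln r"
proof (rule tendsto_sandwich)
  have "r ^ m < r ^ (m + 1)" using assms(1) by simp
  then have k: "0 < k" using assms(2) by simp
  have bounds: "real n * ln r \<le> ln (card (allowed_blocks (T_shift m k) n)) \<and>
        ln (card (allowed_blocks (T_shift m k) n)) \<le> real (n + m) * ln r" for n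
  proof -
    let ?c = "real (card (allowed_blocks (T_shift m k) n))"
    have c: "r ^ n \<le> ?c" "?c \<le> r ^ (n + m)"
      using card_separated_words_bounds[OF assms, of n] k by (simp_all add: allowed_blocks_T_shift)
    have pos: "0 < r ^ n" "0 < r ^ (n + m)" using assms(1) by simp_all
    have "ln (r ^ n) \<le> ln ?c" "ln ?c \<le> ln (r ^ (n + m))"
      using c pos by (auto intro!: ln_mono)
    then show ?thesis using assms(1) by (simp only: ln_realpow)
  qed
  \<comment> \<open>Length 0 is excluded: there division by zero gives \<open>entropy_seq\<close>
    the value 0, below ln r.\<close>
  show "\<forall>\<^sub>F n in sequentially. ln r \<le> entropy_seq (T_shift m k) n"
    using eventually_gt_at_top[of "0::nat"]
    by eventually_elim (use bounds in \<open>simp add: entropy_seq_def field_simps\<close>)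
  show "\<forall>\<^sub>F n in sequentially. entropy_seq (T_shift m k) n \<le> ln r + (real m * ln r) * inverse (real n)"
    using eventually_gt_at_top[of "0::nat"]
    by eventually_elim (use bounds in \<open>simp add: entropy_seq_def field_simps\<close>)
  show "(\<lambda>n. ln r) \<longlonglongrightarrow> ln r" by simp
  show "(\<lambda>n. ln r + (real m * ln r) * inverse (real n)) \<longlonglongrightarrow> ln r"
    by (rule tendsto_eq_intros lim_inverse_n | simp)+
qed

section \<open>Real roots of the equation\<close>

text \<open>Roots are the solutions of s^m (s - 1) = k - 1, whose left side increases strictly for s
  \<ge> 1, so none lies beyond r.\<close>

lemma is_largest_rootI:
  fixes r :: real
  assumes "1 < r" and root: "r ^ (m + 1) = r ^ m + (real k - 1)"
  shows "is_largest_root m k r"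
proof -
  have "s \<le> r" if s: "s ^ (m + 1) = s ^ m + (real k - 1)" for s :: real
  proof (rule ccontr)
    assume "\<not> s \<le> r"
    then have "r < s" by simp
    then have "r ^ m * (r - 1) \<le> s ^ m * (r - 1)"
      using assms(1) by (intro mult_right_mono power_mono) auto
    also have "\<dots> < s ^ m * (s - 1)"
      using \<open>r < s\<close> assms(1) by (intro mult_strict_left_mono) auto
    finally show False using s root by (simp add: algebra_simps)
  qed
  then show ?thesis using root by (simp add: is_largest_root_def)
qed

text \<open>Intermediate value theorem on [1, k]: x^m (x - 1) is 0 at 1 and at least k - 1 at k. The
  value 0 < k - 1 at 1 also rules out the root 1.\<close>

lemma ex_root_gt_1:
  assumes "2 \<le> k"
  obtains r :: real where "1 < r" "r ^ (m + 1) = r ^ m + (real k - 1)"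
proof -
  let ?f = "\<lambda>x::real. x ^ m * (x - 1)"
  have "real k - 1 \<le> real k ^ m * (real k - 1)"
    using assms one_le_power[of "real k" m] mult_right_mono[of 1 "real k ^ m" "real k - 1"] by simp
  then have "\<exists>x\<ge>1. x \<le> real k \<and> ?f x = real k - 1"
    using assms by (intro IVT') (auto intro!: continuous_intros)
  then obtain r where r: "1 \<le> r" "?f r = real k - 1" by blast
  moreover have "r \<noteq> 1" using r assms by auto
  ultimately show ?thesis
    by (intro that[of r]) (auto simp: algebra_simps)
qed

theorem mainTheorem6:
  fixes m k :: nat
  assumes "m \<ge> 1" and "k \<ge> 2"
  shows "convergent (entropy_seq (T_shift m k)) \<and>
         (\<exists>r::real. is_largest_root m k r \<and>
            topological_entropy (T_shift m k) = ln r) \<and>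
         topological_entropy (T_shift 1 k) = ln ((1 + sqrt (4 * real k - 3)) / 2)"
proof -
  obtain r where r: "1 < r" "r ^ (m + 1) = r ^ m + (real k - 1)"
    using ex_root_gt_1[OF assms(2)] by blast
  note lim = entropy_seq_T_shift_tendsto[OF r]
  \<comment> \<open>The larger solution of q^2 = q + (k - 1), the equation for m = 1; k \<ge> 2 puts
    the square root above 1, hence q > 1.\<close>
  define q where "q = (1 + sqrt (4 * real k - 3)) / 2"
  have "sqrt 1 < sqrt (4 * real k - 3)"
    using assms(2) by (intro real_sqrt_less_mono) simp
  then have "1 < q" by (simp add: q_def)
  moreover have "q ^ (1 + 1) = q ^ 1 + (real k - 1)"
    using assms(2) by (simp add: q_def field_simps power2_eq_square)
  ultimately have "entropy_seq (T_shift 1 k) \<longlonglongrightarrow> ln q"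
    by (rule entropy_seq_T_shift_tendsto)
  then have "topological_entropy (T_shift 1 k) = ln q"
    by (simp add: topological_entropy_def limI)
  moreover have "topological_entropy (T_shift m k) = ln r"
    using lim by (simp add: topological_entropy_def limI)
  ultimately show ?thesis
    using lim is_largest_rootI[OF r] by (auto simp: convergent_def q_def)
qed

end
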